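(* Let $d\geq 1$ and $n\geq 0$ be integers, and let $r,s,t$ be nonnegative integers with $r+s+t=dn$. Then the triple of distributions $U(L_d(r)),\ U(L_d(s)),\ U(L_d(t))$ is jointly mixable.
   Context: For an integer $r$, $L_d(r)=\{x\in\{0,1,\ldots,n\}^d : \sum_i x_i=r\}$. For a finite nonempty set $L$, $U(L)$ denotes the uniform distribution on $L$. A triple $(\mu_1,\mu_2,\mu_3)$ of distributions on $\mathbb{R}^d$ is jointly mixable if there is a coupling $(X_1,X_2,X_3)$ with $X_i\sim\mu_i$ for each $i$ such that $X_1+X_2+X_3=\mathbb{E}[\mu_1]+\mathbb{E}[\mu_2]+\mathbb{E}[\mu_3]$ almost surely. *)

theory Defs
  imports "HOL-Probability.Probability"
begin

text \<open>\<open>L\<^sub>d(r)\<close> as a set of points of the Euclidean space \<open>real ^ 'd\<close>, where \<open>d = CARD('d) \<ge> 1\<close>;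
  the paper leaves the dependence on \<open>n\<close> implicit.\<close>

definition lattice_layer :: "nat \<Rightarrow> int \<Rightarrow> (real ^ 'd) set" where
  "lattice_layer n r = {x. (\<forall>i. x $ i \<in> real ` {0..n}) \<and> (\<Sum>i\<in>UNIV. x $ i) = real_of_int r}"

text \<open>The uniform distribution on \<open>L\<close>, as a Borel measure. It is meaningful only for finite
  nonempty \<open>L\<close>.\<close>

definition unif :: "'a::euclidean_space set \<Rightarrow> 'a measure" where
  "unif L = distr (measure_pmf (pmf_of_set L)) borel (\<lambda>x. x)"

text \<open>A coupling is represented by the joint law of \<open>(X\<^sub>1, X\<^sub>2, X\<^sub>3)\<close>. The marginal equations are
  equations between measures on \<open>borel\<close>, so they force each argument to be a Borel probability
  measure.\<close>

definition coupling3 ::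
  "('a::euclidean_space \<times> 'a \<times> 'a) measure \<Rightarrow> 'a measure \<Rightarrow> 'a measure \<Rightarrow> 'a measure \<Rightarrow> bool" where
  "coupling3 P M1 M2 M3 \<longleftrightarrow>
     prob_space P \<and>
     sets P = sets (borel \<Otimes>\<^sub>M (borel \<Otimes>\<^sub>M borel)) \<and>
     distr P borel (\<lambda>(x, y, z). x) = M1 \<and>
     distr P borel (\<lambda>(x, y, z). y) = M2 \<and>
     distr P borel (\<lambda>(x, y, z). z) = M3"

text \<open>The integrability conditions make the three expectations exist; without them the Bochner
  integral would silently be \<open>0\<close>.\<close>

definition jointly_mixable ::
  "'a::euclidean_space measure \<Rightarrow> 'a measure \<Rightarrow> 'a measure \<Rightarrow> bool" where
  "jointly_mixable M1 M2 M3 \<longleftrightarrow>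
     integrable M1 (\<lambda>x. x) \<and> integrable M2 (\<lambda>x. x) \<and> integrable M3 (\<lambda>x. x) \<and>
     (\<exists>P. coupling3 P M1 M2 M3 \<and>
        (AE (x, y, z) in P. x + y + z = (LINT x|M1. x) + (LINT x|M2. x) + (LINT x|M3. x)))"

end

theory Submission
  imports Defs
begin

text \<open>For \<open>d = 2\<close> a layer is an integer interval, and three uniform distributions on intervals of
  lengths \<open>A, B, C\<close> with even sum satisfying the triangle inequalities are coupled with constant sum by
  the squared Wigner 3j symbols: the weights are the squared coefficients of an \<open>sl\<^sub>2\<close>-invariant
  vector in \<open>V\<^sub>A \<otimes> V\<^sub>B \<otimes> V\<^sub>C\<close>, whose marginals are uniform by Schur's lemma.

  For general \<open>d\<close>, consider triples of points in the three layers with coordinatewise sum \<open>n\<close>. Resampling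
  the coordinates \<open>i, j\<close> of all three points by the coupling for \<open>d = 2\<close> stays within such triples and acts
  on each marginal as the Gibbs sampler, which is doubly stochastic. Among all laws on such triples take one
  minimising the sum of the squares of the marginal probabilities. No resampling step can lower
  this quantity further, so the marginals are invariant under moves in two coordinates; as these connect a
  layer, the marginals are uniform.\<close>

section \<open>Invariants of \<open>sl_2\<close> in a tensor product of three irreducible
  representations\<close>

text \<open>\<open>\<phi> a b c\<close> is the coefficient of \<open>x\<^sub>1\<^sup>a x\<^sub>2\<^sup>A\<^sup>-\<^sup>a y\<^sub>1\<^sup>b y\<^sub>2\<^sup>B\<^sup>-\<^sup>b z\<^sub>1\<^sup>c z\<^sub>2\<^sup>C\<^sup>-\<^sup>c\<close> in a trihomogeneous polynomial of
  degrees \<open>A, B, C\<close>; the last two conditions say that the raising and lowering operators of \<open>sl\<^sub>2\<close>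
  annihilate it.\<close>

definition tri_invariant :: "int \<Rightarrow> int \<Rightarrow> int \<Rightarrow> (int \<Rightarrow> int \<Rightarrow> int \<Rightarrow> real) \<Rightarrow> bool" where
  "tri_invariant A B C \<phi> \<longleftrightarrow>
    (\<exists>a b c. \<phi> a b c \<noteq> 0) \<and>
    (\<forall>a b c. \<phi> a b c \<noteq> 0 \<longrightarrow>
      0 \<le> a \<and> a \<le> A \<and> 0 \<le> b \<and> b \<le> B \<and> 0 \<le> c \<and> c \<le> C \<and> 2 * (a + b + c) = A + B + C) \<and>
    (\<forall>a b c. real_of_int (A - a + 1) * \<phi> (a - 1) b c + real_of_int (B - b + 1) * \<phi> a (b - 1) c
      + real_of_int (C - c + 1) * \<phi> a b (c - 1) = 0) \<and>
    (\<forall>a b c. real_of_int (a + 1) * \<phi> (a + 1) b c + real_of_int (b + 1) * \<phi> a (b + 1) c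
      + real_of_int (c + 1) * \<phi> a b (c + 1) = 0)"

text \<open>The three tensor factors play symmetric parts. Rotation lets the construction multiply
  only into the first two factors, and Schur's lemma treat only the first one.\<close>

lemma tri_invariant_rotate:
  assumes "tri_invariant A B C \<phi>"
  shows "tri_invariant B C A (\<lambda>b c a. \<phi> a b c)"
proof -
  note h = assms[unfolded tri_invariant_def]
  show ?thesis unfolding tri_invariant_def
  proof (intro conjI allI)
    show "\<exists>b c a. \<phi> a b c \<noteq> 0" using h by blast
  next
    fix b c a
    show "\<phi> a b c \<noteq> 0 \<longrightarrow>
      0 \<le> b \<and> b \<le> B \<and> 0 \<le> c \<and> c \<le> C \<and> 0 \<le> a \<and> a \<le> A \<and> 2 * (b + c + a) = B + C + A"
      using h by (smt (verit))
    show "real_of_int (B - b + 1) * \<phi> a (b - 1) c + real_of_int (C - c + 1) * \<phi> a b (c - 1)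
      + real_of_int (A - a + 1) * \<phi> (a - 1) b c = 0"
      using h by (smt (verit))
    show "real_of_int (b + 1) * \<phi> a (b + 1) c + real_of_int (c + 1) * \<phi> a b (c + 1)
      + real_of_int (a + 1) * \<phi> (a + 1) b c = 0"
      using h by (smt (verit))
  qed
qed

text \<open>Multiplication of the polynomial by the invariant \<open>x\<^sub>1 y\<^sub>2 - x\<^sub>2 y\<^sub>1\<close>.\<close>

lemma tri_invariant_mult_det:
  assumes "tri_invariant A B C \<phi>"
  shows "tri_invariant (A + 1) (B + 1) C (\<lambda>a b c. \<phi> (a - 1) b c - \<phi> a (b - 1) c)"
proof -
  note h = assms[unfolded tri_invariant_def]
  have supp: "\<phi> a b c \<noteq> 0 \<Longrightarrow>
      0 \<le> a \<and> a \<le> A \<and> 0 \<le> b \<and> b \<le> B \<and> 0 \<le> c \<and> c \<le> C \<and> 2 * (a + b + c) = A + B + C" for a b c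
    using h by blast
  have E: "real_of_int (A - a + 1) * \<phi> (a - 1) b c + real_of_int (B - b + 1) * \<phi> a (b - 1) c
      + real_of_int (C - c + 1) * \<phi> a b (c - 1) = 0" for a b c
    using h by blast
  have F: "real_of_int (a + 1) * \<phi> (a + 1) b c + real_of_int (b + 1) * \<phi> a (b + 1) c
      + real_of_int (c + 1) * \<phi> a b (c + 1) = 0" for a b c
    using h by blast
  show ?thesis unfolding tri_invariant_def
  proof (intro conjI allI)
    \<comment> \<open>A polynomial ring has no zero divisors. Concretely, a vanishing product makes
      \<open>\<phi>\<close> constant along the direction \<open>(1, -1, 0)\<close>, and the shift by
      \<open>b + 1\<close> takes a support point to second index \<open>-1\<close>.\<close>
    show "\<exists>a b c. \<phi> (a - 1) b c - \<phi> a (b - 1) c \<noteq> 0"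
    proof (rule ccontr)
      assume "\<not> ?thesis"
      then have *: "\<phi> (a - 1) b c = \<phi> a (b - 1) c" for a b c by simp
      have shift: "\<phi> a b c = \<phi> (a + int k) (b - int k) c" for a b c k
      proof (induction k)
        case (Suc k)
        then show ?case using *[of "a + int (Suc k)" "b - int k" c] by (simp add: algebra_simps)
      qed simp
      obtain a b c where nz: "\<phi> a b c \<noteq> 0" using h by blast
      have "\<phi> (a + int (nat (b + 1))) (b - int (nat (b + 1))) c \<noteq> 0" using nz shift by metis
      then have "0 \<le> b - int (nat (b + 1))" using supp by blast
      then show False using supp[OF nz] by simp
    qed
  next
    fix a b c
    show "\<phi> (a - 1) b c - \<phi> a (b - 1) c \<noteq> 0 \<longrightarrow> 0 \<le> a \<and> a \<le> A + 1 \<and> 0 \<le> b \<and> b \<le> B + 1 \<and>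
      0 \<le> c \<and> c \<le> C \<and> 2 * (a + b + c) = A + 1 + (B + 1) + C"
    proof
      assume "\<phi> (a - 1) b c - \<phi> a (b - 1) c \<noteq> 0"
      then consider "\<phi> (a - 1) b c \<noteq> 0" | "\<phi> a (b - 1) c \<noteq> 0" by force
      then show "0 \<le> a \<and> a \<le> A + 1 \<and> 0 \<le> b \<and> b \<le> B + 1 \<and>
        0 \<le> c \<and> c \<le> C \<and> 2 * (a + b + c) = A + 1 + (B + 1) + C"
      proof cases
        case 1
        from supp[OF this] show ?thesis by auto
      next
        case 2
        from supp[OF this] show ?thesis by auto
      qed
    qed
    \<comment> \<open>Both operators are derivations that kill the determinant, so each equation for
      the product is the difference of two shifted copies of the equation for
      \<open>\<phi>\<close>.\<close>
    show "real_of_int (A + 1 - a + 1) * (\<phi> (a - 1 - 1) b c - \<phi> (a - 1) (b - 1) c)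
      + real_of_int (B + 1 - b + 1) * (\<phi> (a - 1) (b - 1) c - \<phi> a (b - 1 - 1) c)
      + real_of_int (C - c + 1) * (\<phi> (a - 1) b (c - 1) - \<phi> a (b - 1) (c - 1)) = 0"
      using E[of "a - 1" b c] E[of a "b - 1" c] by (simp add: algebra_simps)
    show "real_of_int (a + 1) * (\<phi> (a + 1 - 1) b c - \<phi> (a + 1) (b - 1) c)
      + real_of_int (b + 1) * (\<phi> (a - 1) (b + 1) c - \<phi> a (b + 1 - 1) c)
      + real_of_int (c + 1) * (\<phi> (a - 1) b (c + 1) - \<phi> a (b - 1) (c + 1)) = 0"
      using F[of "a - 1" b c] F[of a "b - 1" c] by (simp add: algebra_simps)
  qed
qed

lemma tri_invariant_add:
  "\<exists>\<phi>. tri_invariant A B C \<phi> \<Longrightarrow> \<exists>\<phi>. tri_invariant (A + int k) (B + int k) C \<phi>"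
proof (induction k)
  case (Suc k)
  then obtain \<phi> where "tri_invariant (A + int k) (B + int k) C \<phi>" by blast
  from tri_invariant_mult_det[OF this] show ?case by (auto simp: algebra_simps)
qed simp

text \<open>The determinants of the pairs \<open>(x, y)\<close>, \<open>(y, z)\<close>,
  \<open>(z, x)\<close> are multiplied together with exponents \<open>N - C\<close>,
  \<open>N - A\<close>, \<open>N - B\<close>. The triangle inequalities make these nonnegative, and
  the degree in \<open>x\<close> is \<open>(N - C) + (N - B) = A\<close>; likewise for
  \<open>y\<close> and \<open>z\<close>.\<close>

lemma tri_invariant_exists:
  assumes "A \<le> B + C" and "B \<le> C + A" and "C \<le> A + B" and "A + B + C = 2 * N"
  shows "\<exists>\<phi>. tri_invariant A B C \<phi>"
proof -
  have B: "int (nat (N - C)) + int (nat (N - A)) = B"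
    and AC: "int (nat (N - A)) + int (nat (N - B)) = C" "int (nat (N - C)) + int (nat (N - B)) = A"
    using assms by auto
  have "tri_invariant 0 0 0 (\<lambda>a b c. if a = 0 \<and> b = 0 \<and> c = 0 then 1 else 0)"
    unfolding tri_invariant_def by auto
  then have "\<exists>\<phi>. tri_invariant 0 0 0 \<phi>" by blast
  from tri_invariant_add[OF this, of "nat (N - C)"]
  have "\<exists>\<phi>. tri_invariant (nat (N - C)) (nat (N - C)) 0 \<phi>" by simp
  then have "\<exists>\<phi>. tri_invariant (nat (N - C)) 0 (nat (N - C)) \<phi>"
    using tri_invariant_rotate by blast
  from tri_invariant_add[OF this, of "nat (N - A)"]
  have "\<exists>\<phi>. tri_invariant B (nat (N - A)) (nat (N - C)) \<phi>"
    unfolding B by simp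
  then have "\<exists>\<phi>. tri_invariant (nat (N - A)) (nat (N - C)) B \<phi>"
    using tri_invariant_rotate by blast
  from tri_invariant_add[OF this, of "nat (N - B)"]
  have "\<exists>\<phi>. tri_invariant C A B \<phi>"
    unfolding AC by simp
  then show ?thesis using tri_invariant_rotate by blast
qed

section \<open>The invariant inner product and uniform marginals\<close>

text \<open>Squared norm of the monomial \<open>x\<^sub>1\<^sup>a x\<^sub>2\<^sup>A\<^sup>-\<^sup>a\<close> in the inner product that makes the raising and lowering
  operators adjoint to each other.\<close>

definition mono_norm :: "int \<Rightarrow> int \<Rightarrow> real" where
  "mono_norm A a = fact (nat a) * fact (nat (A - a))"

lemma mono_norm_pos: "0 < mono_norm A a"
  by (simp add: mono_norm_def)

text \<open>Adjointness on the monomial basis: raising sends the monomial of index \<open>a\<close>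
  to \<open>A - a\<close> times the next one, and lowering sends that one to \<open>a + 1\<close>
  times the former.\<close>

lemma mono_norm_step:
  assumes "0 \<le> a" and "a < A"
  shows "real_of_int (A - a) * mono_norm A (a + 1) = real_of_int (a + 1) * mono_norm A a"
proof -
  have "nat (a + 1) = Suc (nat a)" "nat (A - a) = Suc (nat (A - (a + 1)))"
    using assms by auto
  then show ?thesis using assms unfolding mono_norm_def by (simp add: algebra_simps)
qed

lemma sum_int_shift:
  fixes G :: "int \<Rightarrow> real"
  assumes "0 \<le> B" and "G 0 = 0" and "G (B + 1) = 0"
  shows "(\<Sum>b\<in>{0..B}. G b) = (\<Sum>b\<in>{0..B}. G (b + 1))"
proof -
  have "(\<Sum>b\<in>{0..B}. G (b + 1)) = (\<Sum>b\<in>{1..B + 1}. G b)"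
    by (rule sum.reindex_bij_witness[of _ "\<lambda>b. b - 1" "\<lambda>b. b + 1"]) auto
  moreover have "{0..B + 1} = insert 0 {1..B + 1}" using assms(1) by auto
  then have "(\<Sum>b\<in>{0..B + 1}. G b) = (\<Sum>b\<in>{1..B + 1}. G b)" using assms(2) by simp
  moreover have "{0..B + 1} = insert (B + 1) {0..B}" using assms(1) by auto
  then have "(\<Sum>b\<in>{0..B + 1}. G b) = (\<Sum>b\<in>{0..B}. G b)" using assms(3) by simp
  ultimately show ?thesis by simp
qed

text \<open>As \<open>mono_norm\<close> is a squared norm, this is the squared coefficient of the
  invariant in an orthonormal basis of monomials: a squared Wigner 3j symbol up to
  normalisation.\<close>

definition tri_weight ::
  "int \<Rightarrow> int \<Rightarrow> int \<Rightarrow> (int \<Rightarrow> int \<Rightarrow> int \<Rightarrow> real) \<Rightarrow> int \<Rightarrow> int \<Rightarrow> int \<Rightarrow> real" where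
  "tri_weight A B C \<phi> a b c = (\<phi> a b c)\<^sup>2 * (mono_norm A a * mono_norm B b * mono_norm C c)"

text \<open>Schur's lemma for the first factor: apply the raising equation to one copy of \<open>\<phi>\<close>, move the
  operators on the other two factors to the second copy, and apply the lowering equation there.\<close>

lemma tri_weight_slice_step:
  assumes inv: "tri_invariant A B C \<phi>" and a: "0 \<le> a" "a < A"
  shows "(\<Sum>b\<in>{0..B}. \<Sum>c\<in>{0..C}. tri_weight A B C \<phi> a b c)
    = (\<Sum>b\<in>{0..B}. \<Sum>c\<in>{0..C}. tri_weight A B C \<phi> (a + 1) b c)"
proof -
  note h = inv[unfolded tri_invariant_def]
  have supp: "\<phi> a b c \<noteq> 0 \<Longrightarrow>
      0 \<le> a \<and> a \<le> A \<and> 0 \<le> b \<and> b \<le> B \<and> 0 \<le> c \<and> c \<le> C" for a b c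
    using h by blast
  have BC: "0 \<le> B" "0 \<le> C" using h by fastforce+
  have E: "real_of_int (A - a) * \<phi> a b c = - (real_of_int (B - b + 1) * \<phi> (a + 1) (b - 1) c)
      - real_of_int (C - c + 1) * \<phi> (a + 1) b (c - 1)" for b c
  proof -
    have "real_of_int (A - (a + 1) + 1) * \<phi> (a + 1 - 1) b c + real_of_int (B - b + 1) * \<phi> (a + 1) (b - 1) c
      + real_of_int (C - c + 1) * \<phi> (a + 1) b (c - 1) = 0"
      using h by blast
    then show ?thesis by simp
  qed
  have F: "real_of_int (b + 1) * \<phi> a (b + 1) c + real_of_int (c + 1) * \<phi> a b (c + 1)
     = - (real_of_int (a + 1) * \<phi> (a + 1) b c)" for b c
  proof -
    have "real_of_int (a + 1) * \<phi> (a + 1) b c + real_of_int (b + 1) * \<phi> a (b + 1) c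
      + real_of_int (c + 1) * \<phi> a b (c + 1) = 0"
      using h by blast
    then show ?thesis by simp
  qed
  \<comment> \<open>Adjointness in one factor, shifted down by one. At \<open>m = 0\<close> the
    right side is 0 because of the factor \<open>m\<close>, so there \<open>u\<close> itself has to
    vanish.\<close>
  have down: "real_of_int (M - m + 1) * mono_norm M m * u = real_of_int m * mono_norm M (m - 1) * u"
    if "m \<in> {0..M}" and "m = 0 \<Longrightarrow> u = 0" for M m u
  proof (cases "m = 0")
    case False
    then show ?thesis using that(1) mono_norm_step[of "m - 1" M] by (simp add: algebra_simps)
  qed (use that in simp)
  let ?N = "\<lambda>b c. mono_norm B b * mono_norm C c"
  \<comment> \<open>\<open>G\<close> and \<open>H\<close> pair slice \<open>a\<close> with slice
    \<open>a + 1\<close> raised in the second and in the third factor; adjointness is already built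
    into their norms.\<close>
  define G where "G b c = real_of_int b * (mono_norm B (b - 1) * mono_norm C c)
    * (\<phi> (a + 1) (b - 1) c * \<phi> a b c)" for b c
  define H where "H b c = real_of_int c * (mono_norm B b * mono_norm C (c - 1))
    * (\<phi> (a + 1) b (c - 1) * \<phi> a b c)" for b c
  have "real_of_int (A - a) * (\<Sum>b\<in>{0..B}. \<Sum>c\<in>{0..C}. (\<phi> a b c)\<^sup>2 * ?N b c)
      = (\<Sum>b\<in>{0..B}. \<Sum>c\<in>{0..C}. (real_of_int (A - a) * \<phi> a b c) * (\<phi> a b c * ?N b c))"
    by (simp add: sum_distrib_left power2_eq_square mult_ac)
  also have "\<dots> = (\<Sum>b\<in>{0..B}. \<Sum>c\<in>{0..C}. - (G b c) - H b c)"
  proof (intro sum.cong refl)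
    fix b c assume bc: "b \<in> {0..B}" "c \<in> {0..C}"
    have 1: "real_of_int (B - b + 1) * mono_norm B b * \<phi> (a + 1) (b - 1) c
      = real_of_int b * mono_norm B (b - 1) * \<phi> (a + 1) (b - 1) c"
      using bc supp[of "a + 1" "b - 1" c] by (intro down) auto
    have 2: "real_of_int (C - c + 1) * mono_norm C c * \<phi> (a + 1) b (c - 1)
      = real_of_int c * mono_norm C (c - 1) * \<phi> (a + 1) b (c - 1)"
      using bc supp[of "a + 1" b "c - 1"] by (intro down) auto
    have "(real_of_int (A - a) * \<phi> a b c) * (\<phi> a b c * ?N b c)
      = - ((real_of_int (B - b + 1) * mono_norm B b * \<phi> (a + 1) (b - 1) c) * mono_norm C c * \<phi> a b c)
      - (real_of_int (C - c + 1) * mono_norm C c * \<phi> (a + 1) b (c - 1)) * mono_norm B b * \<phi> a b c"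
      unfolding E by (simp add: algebra_simps)
    also have "\<dots> = - (G b c) - H b c"
      unfolding 1 2 G_def H_def by (simp add: mult_ac)
    finally show "(real_of_int (A - a) * \<phi> a b c) * (\<phi> a b c * ?N b c) = - (G b c) - H b c" .
  qed
  also have "\<dots> = - (\<Sum>c\<in>{0..C}. \<Sum>b\<in>{0..B}. G b c) - (\<Sum>b\<in>{0..B}. \<Sum>c\<in>{0..C}. H b c)"
    using sum.swap[of G "{0..C}" "{0..B}"] by (simp add: sum_subtractf sum_negf)
  \<comment> \<open>The index shift turns raising of slice \<open>a + 1\<close> into lowering of
    slice \<open>a\<close>. Boundary terms vanish: \<open>G\<close> carries the factor
    \<open>b\<close>, and \<open>\<phi>\<close> is zero at index \<open>B + 1\<close>.\<close>
  also have "(\<Sum>c\<in>{0..C}. \<Sum>b\<in>{0..B}. G b c) = (\<Sum>c\<in>{0..C}. \<Sum>b\<in>{0..B}. G (b + 1) c)"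
    using BC supp[of a "B + 1"] by (intro sum.cong refl sum_int_shift) (auto simp: G_def)
  also have "(\<Sum>b\<in>{0..B}. \<Sum>c\<in>{0..C}. H b c) = (\<Sum>b\<in>{0..B}. \<Sum>c\<in>{0..C}. H b (c + 1))"
    using BC supp[of a _ "C + 1"] by (intro sum.cong refl sum_int_shift) (auto simp: H_def)
  also have "- (\<Sum>c\<in>{0..C}. \<Sum>b\<in>{0..B}. G (b + 1) c) - (\<Sum>b\<in>{0..B}. \<Sum>c\<in>{0..C}. H b (c + 1))
      = (\<Sum>b\<in>{0..B}. \<Sum>c\<in>{0..C}. - (G (b + 1) c) - H b (c + 1))"
    using sum.swap[of "\<lambda>b c. G (b + 1) c" "{0..C}" "{0..B}"] by (simp add: sum_subtractf sum_negf)
  also have "\<dots> = (\<Sum>b\<in>{0..B}. \<Sum>c\<in>{0..C}. real_of_int (a + 1) * ((\<phi> (a + 1) b c)\<^sup>2 * ?N b c))"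
  proof (intro sum.cong refl)
    fix b c
    have "- (G (b + 1) c) - H b (c + 1) = - (?N b c * \<phi> (a + 1) b c *
      (real_of_int (b + 1) * \<phi> a (b + 1) c + real_of_int (c + 1) * \<phi> a b (c + 1)))"
      unfolding G_def H_def by (simp add: algebra_simps)
    then show "- (G (b + 1) c) - H b (c + 1) = real_of_int (a + 1) * ((\<phi> (a + 1) b c)\<^sup>2 * ?N b c)"
      unfolding F by (simp add: algebra_simps power2_eq_square)
  qed
  finally have *: "real_of_int (A - a) * (\<Sum>b\<in>{0..B}. \<Sum>c\<in>{0..C}. (\<phi> a b c)\<^sup>2 * ?N b c)
      = real_of_int (a + 1) * (\<Sum>b\<in>{0..B}. \<Sum>c\<in>{0..C}. (\<phi> (a + 1) b c)\<^sup>2 * ?N b c)"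
    by (simp add: sum_distrib_left)
  have w: "(\<Sum>b\<in>{0..B}. \<Sum>c\<in>{0..C}. tri_weight A B C \<phi> x b c)
      = mono_norm A x * (\<Sum>b\<in>{0..B}. \<Sum>c\<in>{0..C}. (\<phi> x b c)\<^sup>2 * ?N b c)" for x
    by (simp add: tri_weight_def sum_distrib_left mult_ac)
  \<comment> \<open>The norm of the first factor, left out so far, absorbs the ratio of
    \<open>a + 1\<close> to \<open>A - a\<close>, and \<open>A - a\<close> is positive.\<close>
  have "real_of_int (A - a) * (mono_norm A a * (\<Sum>b\<in>{0..B}. \<Sum>c\<in>{0..C}. (\<phi> a b c)\<^sup>2 * ?N b c))
    = (real_of_int (a + 1) * mono_norm A a) * (\<Sum>b\<in>{0..B}. \<Sum>c\<in>{0..C}. (\<phi> (a + 1) b c)\<^sup>2 * ?N b c)"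
    using * by (simp add: mult_ac)
  also have "\<dots> = real_of_int (A - a) * (mono_norm A (a + 1) *
      (\<Sum>b\<in>{0..B}. \<Sum>c\<in>{0..C}. (\<phi> (a + 1) b c)\<^sup>2 * ?N b c))"
    unfolding mono_norm_step[OF a, symmetric] by (simp add: mult_ac)
  finally show ?thesis unfolding w using a by simp
qed

lemma tri_weight_slice:
  assumes inv: "tri_invariant A B C \<phi>" and a: "a \<in> {0..A}"
  shows "(\<Sum>b\<in>{0..B}. \<Sum>c\<in>{0..C}. tri_weight A B C \<phi> a b c) =
    (\<Sum>a\<in>{0..A}. \<Sum>b\<in>{0..B}. \<Sum>c\<in>{0..C}. tri_weight A B C \<phi> a b c) / real_of_int (A + 1)"
proof -
  let ?s = "\<lambda>a. \<Sum>b\<in>{0..B}. \<Sum>c\<in>{0..C}. tri_weight A B C \<phi> a b c"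
  have "?s (int k) = ?s 0" if "int k \<le> A" for k
    using that
  proof (induction k)
    case (Suc k)
    then show ?case using tri_weight_slice_step[OF inv, of "int k"] by (simp add: add.commute)
  qed simp
  then have s0: "?s x = ?s 0" if "x \<in> {0..A}" for x
    using that by (cases x rule: int_cases) auto
  have "(\<Sum>x\<in>{0..A}. ?s x) = (\<Sum>x\<in>{0..A}. ?s 0)" by (intro sum.cong refl s0)
  also have "\<dots> = real_of_int (A + 1) * ?s 0" using a by simp
  finally show ?thesis using a s0[OF a] by simp
qed

section \<open>Finite mass functions, doubly stochastic steps and energy minimisers\<close>

lemma pmf_of_weights:
  fixes w :: "'a \<Rightarrow> real"
  assumes "finite S" and "\<And>x. x \<in> S \<Longrightarrow> 0 \<le> w x" and "sum w S = 1"
  obtains p where "\<And>x. pmf p x = (if x \<in> S then w x else 0)" and "set_pmf p \<subseteq> S"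
proof -
  define v where "v x = (if x \<in> S then w x else 0)" for x
  have v0: "0 \<le> v x" for x using assms(2) by (simp add: v_def)
  have "(\<integral>\<^sup>+x. ennreal (v x) \<partial>count_space UNIV) = (\<integral>\<^sup>+x. ennreal (v x) \<partial>count_space S)"
    by (rule nn_integral_count_space_eq) (auto simp: v_def)
  also have "\<dots> = (\<Sum>x\<in>S. ennreal (v x))"
    by (rule nn_integral_count_space_finite[OF assms(1)])
  also have "\<dots> = ennreal (\<Sum>x\<in>S. v x)"
    using v0 by (simp add: sum_ennreal)
  also have "(\<Sum>x\<in>S. v x) = 1" using assms(3) by (simp add: v_def)
  finally have "(\<integral>\<^sup>+x. ennreal (v x) \<partial>count_space UNIV) = 1" by simp
  then have p: "pmf (embed_pmf v) x = v x" for x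
    by (intro pmf_embed_pmf v0)
  moreover have "set_pmf (embed_pmf v) \<subseteq> S"
    by (auto simp: set_pmf_iff p v_def split: if_splits)
  ultimately show ?thesis using that unfolding v_def by blast
qed

lemma pmf_map_eq_sum:
  assumes "finite S" and "set_pmf p \<subseteq> S"
  shows "pmf (map_pmf f p) a = (\<Sum>x\<in>{x \<in> S. f x = a}. pmf p x)"
proof -
  have "pmf (map_pmf f p) a = measure (measure_pmf p) {x \<in> S. f x = a}"
    unfolding pmf_map using assms(2) by (intro measure_prob_cong_0) (auto simp: set_pmf_iff)
  then show ?thesis using assms(1) by (simp add: measure_measure_pmf_finite)
qed

lemma pmf_bind_eq_sum:
  assumes "finite S" and "set_pmf p \<subseteq> S"
  shows "pmf (bind_pmf p k) a = (\<Sum>x\<in>S. pmf p x * pmf (k x) a)"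
  unfolding pmf_bind using assms
  by (subst integral_measure_pmf[of S]) auto

text \<open>A doubly stochastic step decreases the sum of squares, strictly unless \<open>p\<close> is locally constant.\<close>

lemma doubly_stochastic_energy:
  fixes p q :: "'a \<Rightarrow> real" and k :: "'a \<Rightarrow> 'a \<Rightarrow> real"
  assumes row: "\<And>x. x \<in> S \<Longrightarrow> (\<Sum>a\<in>S. k x a) = 1"
    and col: "\<And>a. a \<in> S \<Longrightarrow> (\<Sum>x\<in>S. k x a) = 1"
    and q: "\<And>a. a \<in> S \<Longrightarrow> q a = (\<Sum>x\<in>S. p x * k x a)"
  shows "(\<Sum>x\<in>S. (p x)\<^sup>2) - (\<Sum>a\<in>S. (q a)\<^sup>2) = (\<Sum>a\<in>S. \<Sum>x\<in>S. k x a * (p x - q a)\<^sup>2)"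
proof -
  \<comment> \<open>The column weights sum to 1 and \<open>q a\<close> is the mean of
    \<open>p\<close> under them, so this is the variance formula.\<close>
  have "(\<Sum>x\<in>S. k x a * (p x - q a)\<^sup>2) = (\<Sum>x\<in>S. k x a * (p x)\<^sup>2) - (q a)\<^sup>2" if a: "a \<in> S" for a
  proof -
    have "(\<Sum>x\<in>S. k x a * (p x - q a)\<^sup>2)
        = (\<Sum>x\<in>S. k x a * (p x)\<^sup>2 - 2 * q a * (p x * k x a) + (q a)\<^sup>2 * k x a)"
      by (intro sum.cong refl) (simp add: power2_eq_square algebra_simps)
    also have "\<dots> = (\<Sum>x\<in>S. k x a * (p x)\<^sup>2) - 2 * q a * (\<Sum>x\<in>S. p x * k x a)
        + (q a)\<^sup>2 * (\<Sum>x\<in>S. k x a)"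
      by (simp add: sum.distrib sum_subtractf sum_distrib_left)
    also have "\<dots> = (\<Sum>x\<in>S. k x a * (p x)\<^sup>2) - (q a)\<^sup>2"
      by (simp add: q[OF a, symmetric] col[OF a] power2_eq_square)
    finally show ?thesis .
  qed
  moreover have "(\<Sum>a\<in>S. \<Sum>x\<in>S. k x a * (p x)\<^sup>2) = (\<Sum>x\<in>S. (p x)\<^sup>2)"
    by (subst sum.swap) (simp add: sum_distrib_right[symmetric] row)
  ultimately show ?thesis by (simp add: sum_subtractf)
qed

text \<open>The laws on a finite set form a compact simplex, on which the energy of the marginals is
  continuous.\<close>

lemma marginal_energy_minimiser:
  fixes \<Omega> :: "'w set" and M :: "('w \<Rightarrow> 'b) set"
  assumes fin: "finite \<Omega>" and ne: "\<Omega> \<noteq> {}"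
  obtains \<pi> where "set_pmf \<pi> \<subseteq> \<Omega>"
    and "\<And>p. set_pmf p \<subseteq> \<Omega> \<Longrightarrow>
      (\<Sum>f\<in>M. \<Sum>a\<in>A. (pmf (map_pmf f \<pi>) a)\<^sup>2) \<le> (\<Sum>f\<in>M. \<Sum>a\<in>A. (pmf (map_pmf f p) a)\<^sup>2)"
proof -
  \<comment> \<open>Written with sums over fibres, the energy is defined for every real function; on
    mass functions supported in \<open>\<Omega>\<close> it is the required sum of squares.\<close>
  define energy :: "('w \<Rightarrow> real) \<Rightarrow> real" where
    "energy v = (\<Sum>f\<in>M. \<Sum>a\<in>A. (\<Sum>x\<in>{x \<in> \<Omega>. f x = a}. v x)\<^sup>2)" for v
  \<comment> \<open>Coordinates outside \<open>\<Omega>\<close> are pinned to 0, so the box is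
    compact in the whole function space by Tychonoff's theorem.\<close>
  define box :: "('w \<Rightarrow> real) set" where
    "box = Pi\<^sub>E UNIV (\<lambda>x. if x \<in> \<Omega> then {0..1} else {0})"
  define D where "D = box \<inter> {v. sum v \<Omega> = 1}"
  have en: "energy (pmf p) = (\<Sum>f\<in>M. \<Sum>a\<in>A. (pmf (map_pmf f p) a)\<^sup>2)" if "set_pmf p \<subseteq> \<Omega>" for p
    unfolding energy_def by (simp add: pmf_map_eq_sum[OF fin that])
  have inD: "pmf p \<in> D" if "set_pmf p \<subseteq> \<Omega>" for p
    using that fin by (auto simp: D_def box_def pmf_le_1 set_pmf_iff sum_pmf_eq_1)
  have "compactin (product_topology (\<lambda>_. euclidean) UNIV) box"
    unfolding box_def by (subst compactin_PiE) auto
  then have "compact box"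
    by (simp add: euclidean_product_topology)
  moreover have "closed {v :: 'w \<Rightarrow> real. sum v \<Omega> = 1}"
    by (intro closed_Collect_eq continuous_intros continuous_on_product_coordinates)
  ultimately have "compact D" unfolding D_def by (rule compact_Int_closed)
  moreover have "continuous_on D energy"
    unfolding energy_def
    by (intro continuous_intros continuous_on_subset[OF continuous_on_product_coordinates]) simp
  moreover obtain \<omega> where "\<omega> \<in> \<Omega>" using ne by blast
  then have "D \<noteq> {}" using inD[of "return_pmf \<omega>"] by auto
  ultimately obtain v where v: "v \<in> D" "\<And>u. u \<in> D \<Longrightarrow> energy v \<le> energy u"
    using continuous_attains_inf[of D energy] by blast
  have v01: "v x \<in> (if x \<in> \<Omega> then {0..1} else {0})" for x
    using v(1) by (auto simp: D_def box_def PiE_iff)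
  obtain \<pi> where \<pi>: "\<And>x. pmf \<pi> x = (if x \<in> \<Omega> then v x else 0)" "set_pmf \<pi> \<subseteq> \<Omega>"
  proof (rule pmf_of_weights[OF fin, of v])
    show "0 \<le> v x" if "x \<in> \<Omega>" for x using v01[of x] that by simp
    show "sum v \<Omega> = 1" using v(1) by (simp add: D_def)
  qed blast
  have "pmf \<pi> = v"
  proof
    show "pmf \<pi> x = v x" for x using v01[of x] by (cases "x \<in> \<Omega>") (simp_all add: \<pi>(1))
  qed
  then show ?thesis
    using that[OF \<pi>(2)] v(2) inD en \<pi>(2) by metis
qed

text \<open>The step \<open>T i\<close> acts on all marginals at once as the doubly stochastic
  \<open>K i\<close>. From a minimiser no step can lose energy, yet the loss is a sum of nonnegative
  terms \<open>pmf (K i x) a * (p x - q a)^2\<close>. Hence \<open>p x = q a\<close> whenever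
  \<open>K i x\<close> charges \<open>a\<close>, and two points that reach a common \<open>a\<close>
  are equally likely.\<close>

lemma coupling_with_kernel_invariant_marginals:
  fixes \<Omega> :: "'w set" and M :: "('w \<Rightarrow> 'b) set"
    and T :: "'i \<Rightarrow> 'w \<Rightarrow> 'w pmf" and K :: "'i \<Rightarrow> 'b \<Rightarrow> 'b pmf"
  assumes fin: "finite \<Omega>" "\<Omega> \<noteq> {}" "finite M" "finite A"
    and M: "\<And>f \<omega>. f \<in> M \<Longrightarrow> \<omega> \<in> \<Omega> \<Longrightarrow> f \<omega> \<in> A"
    and T: "\<And>i \<omega>. i \<in> I \<Longrightarrow> \<omega> \<in> \<Omega> \<Longrightarrow> set_pmf (T i \<omega>) \<subseteq> \<Omega>"
    and TK: "\<And>i \<omega> f. i \<in> I \<Longrightarrow> \<omega> \<in> \<Omega> \<Longrightarrow> f \<in> M \<Longrightarrow> map_pmf f (T i \<omega>) = K i (f \<omega>)"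
    and K: "\<And>i x. i \<in> I \<Longrightarrow> x \<in> A \<Longrightarrow> set_pmf (K i x) \<subseteq> A"
    and col: "\<And>i a. i \<in> I \<Longrightarrow> a \<in> A \<Longrightarrow> (\<Sum>x\<in>A. pmf (K i x) a) = 1"
  obtains \<pi> where "set_pmf \<pi> \<subseteq> \<Omega>"
    and "\<And>f i x x' a. f \<in> M \<Longrightarrow> i \<in> I \<Longrightarrow> x \<in> A \<Longrightarrow> x' \<in> A \<Longrightarrow>
      a \<in> set_pmf (K i x) \<Longrightarrow> a \<in> set_pmf (K i x') \<Longrightarrow>
      pmf (map_pmf f \<pi>) x = pmf (map_pmf f \<pi>) x'"
proof -
  obtain \<pi> where \<pi>: "set_pmf \<pi> \<subseteq> \<Omega>" and min: "\<And>p. set_pmf p \<subseteq> \<Omega> \<Longrightarrow>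
      (\<Sum>f\<in>M. \<Sum>a\<in>A. (pmf (map_pmf f \<pi>) a)\<^sup>2) \<le> (\<Sum>f\<in>M. \<Sum>a\<in>A. (pmf (map_pmf f p) a)\<^sup>2)"
    using marginal_energy_minimiser[OF fin(1,2)] by metis
  have main: "pmf (map_pmf f \<pi>) x = pmf (bind_pmf (map_pmf f \<pi>) (K i)) a"
    if f: "f \<in> M" and i: "i \<in> I" and x: "x \<in> A" and a: "a \<in> set_pmf (K i x)" for f i x a
  proof -
    define q where "q f = bind_pmf (map_pmf f \<pi>) (K i)" for f :: "'w \<Rightarrow> 'b"
    define p' where "p' = bind_pmf \<pi> (T i)"
    define gap where "gap f = (\<Sum>a\<in>A. \<Sum>x\<in>A. pmf (K i x) a * (pmf (map_pmf f \<pi>) x - pmf (q f) a)\<^sup>2)"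
      for f
    have p': "set_pmf p' \<subseteq> \<Omega>" using \<pi> T[OF i] by (auto simp: p'_def)
    have map: "map_pmf g p' = q g" if "g \<in> M" for g
      unfolding p'_def q_def map_bind_pmf bind_map_pmf
      using \<pi> TK[OF i _ that] by (intro bind_pmf_cong) auto
    have sub: "set_pmf (map_pmf g \<pi>) \<subseteq> A" if "g \<in> M" for g
      using \<pi> M[OF that] by auto
    have "(\<Sum>x\<in>A. (pmf (map_pmf g \<pi>) x)\<^sup>2) - (\<Sum>a\<in>A. (pmf (q g) a)\<^sup>2) = gap g" if "g \<in> M" for g
      unfolding gap_def
    proof (rule doubly_stochastic_energy)
      show "(\<Sum>a\<in>A. pmf (K i x) a) = 1" if "x \<in> A" for x
        using K[OF i that] fin(4) by (intro sum_pmf_eq_1)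
      show "(\<Sum>x\<in>A. pmf (K i x) a) = 1" if "a \<in> A" for a using col[OF i that] .
      show "pmf (q g) a = (\<Sum>x\<in>A. pmf (map_pmf g \<pi>) x * pmf (K i x) a)" for a
        unfolding q_def by (rule pmf_bind_eq_sum[OF fin(4) sub[OF that]])
    qed
    then have "(\<Sum>g\<in>M. gap g) = (\<Sum>f\<in>M. \<Sum>a\<in>A. (pmf (map_pmf f \<pi>) a)\<^sup>2)
        - (\<Sum>f\<in>M. \<Sum>a\<in>A. (pmf (map_pmf f p') a)\<^sup>2)"
      by (simp add: sum_subtractf[symmetric] map)
    with min[OF p'] have "(\<Sum>g\<in>M. gap g) \<le> 0" by simp
    moreover have g0: "0 \<le> gap g" for g unfolding gap_def by (intro sum_nonneg) auto
    ultimately have "(\<Sum>g\<in>M. gap g) = 0" using sum_nonneg[of M gap] by fastforce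
    then have "gap f = 0" using f fin(3) g0 by (simp add: sum_nonneg_eq_0_iff)
    moreover have "a \<in> A" using K[OF i x] a by blast
    ultimately have "pmf (K i x) a * (pmf (map_pmf f \<pi>) x - pmf (q f) a)\<^sup>2 = 0"
      unfolding gap_def using x fin(4) by (simp add: sum_nonneg_eq_0_iff sum_nonneg)
    then show ?thesis using a by (simp add: q_def set_pmf_iff)
  qed
  show ?thesis by (rule that[OF \<pi>]) (metis main)
qed

section \<open>Coupling of three uniform distributions on integer intervals\<close>

lemma pmf_eq_pmf_of_set:
  assumes "finite S" and "S \<noteq> {}" and "set_pmf p \<subseteq> S" and "\<And>x. x \<in> S \<Longrightarrow> pmf p x = 1 / real (card S)"
  shows "p = pmf_of_set S"
proof (rule pmf_eqI)
  fix x
  show "pmf p x = pmf (pmf_of_set S) x"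
    using assms by (cases "x \<in> S") (auto simp: set_pmf_iff)
qed

text \<open>The normalised \<open>tri_weight\<close> is the mass function of the coupling. The
  support of \<open>\<phi>\<close> gives the constant sum, and equality of all slices in each
  direction gives the uniform marginals.\<close>

lemma uniform_interval_coupling_zero:
  fixes A B C N :: int
  assumes "A \<le> B + C" and "B \<le> C + A" and "C \<le> A + B" and "A + B + C = 2 * N"
  obtains p where "set_pmf p \<subseteq> {(a, b, c). a + b + c = N}"
    and "map_pmf fst p = pmf_of_set {0..A}"
    and "map_pmf (fst \<circ> snd) p = pmf_of_set {0..B}"
    and "map_pmf (snd \<circ> snd) p = pmf_of_set {0..C}"
proof -
  have nonneg: "0 \<le> A" "0 \<le> B" "0 \<le> C" using assms by auto
  obtain \<phi> where inv: "tri_invariant A B C \<phi>" using tri_invariant_exists[OF assms] by blast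
  note inv2 = tri_invariant_rotate[OF inv] and inv3 = tri_invariant_rotate[OF tri_invariant_rotate[OF inv]]
  have supp: "0 \<le> a \<and> a \<le> A \<and> 0 \<le> b \<and> b \<le> B \<and> 0 \<le> c \<and> c \<le> C \<and> a + b + c = N"
    if "\<phi> a b c \<noteq> 0" for a b c
  proof -
    have "0 \<le> a \<and> a \<le> A \<and> 0 \<le> b \<and> b \<le> B \<and> 0 \<le> c \<and> c \<le> C \<and> 2 * (a + b + c) = A + B + C"
      using inv that unfolding tri_invariant_def by blast
    then show ?thesis using assms(4) by auto
  qed
  define w where "w = tri_weight A B C \<phi>"
  have w0: "0 \<le> w a b c" for a b c
    unfolding w_def tri_weight_def by (simp add: less_imp_le mono_norm_pos)
  have w_pos: "w a b c \<noteq> 0 \<longleftrightarrow> \<phi> a b c \<noteq> 0" for a b c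
    unfolding w_def tri_weight_def using mono_norm_pos[of A a] mono_norm_pos[of B b] mono_norm_pos[of C c]
    by simp
  define S where "S = {0..A} \<times> {0..B} \<times> {0..C}"
  have finS: "finite S" by (simp add: S_def)
  define W where "W = (\<Sum>a\<in>{0..A}. \<Sum>b\<in>{0..B}. \<Sum>c\<in>{0..C}. w a b c)"
  have W_S: "W = (\<Sum>(a, b, c)\<in>S. w a b c)"
    unfolding W_def S_def by (simp add: sum.cartesian_product)
  have "W > 0"
  proof -
    obtain a b c where nz: "\<phi> a b c \<noteq> 0" using inv unfolding tri_invariant_def by blast
    then have "(a, b, c) \<in> S" using supp[OF nz] by (simp add: S_def)
    moreover have "0 < w a b c" using nz w0[of a b c] w_pos[of a b c] by linarith
    ultimately show ?thesis unfolding W_S using w0 finS by (intro sum_pos2[of S "(a, b, c)"]) auto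
  qed
  obtain p where p: "\<And>x. pmf p x = (if x \<in> S then (case x of (a, b, c) \<Rightarrow> w a b c / W) else 0)"
    and pS: "set_pmf p \<subseteq> S"
  proof (rule pmf_of_weights[OF finS, of "\<lambda>(a, b, c). w a b c / W"])
    show "(case x of (a, b, c) \<Rightarrow> w a b c / W) \<ge> 0" for x
      using w0 \<open>W > 0\<close> by (auto split: prod.split)
    show "(\<Sum>(a, b, c)\<in>S. w a b c / W) = 1"
      using \<open>W > 0\<close> W_S by (simp add: case_prod_unfold sum_divide_distrib[symmetric])
  qed blast
  have slice1: "(\<Sum>b\<in>{0..B}. \<Sum>c\<in>{0..C}. w a b c) = W / real_of_int (A + 1)" if "a \<in> {0..A}" for a
    unfolding W_def w_def by (rule tri_weight_slice[OF inv that])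
  \<comment> \<open>The rotated invariant has the same weights up to the order of factors and
    summations, so the slice formula for the first factor serves the second.\<close>
  have slice2: "(\<Sum>c\<in>{0..C}. \<Sum>a\<in>{0..A}. w a b c) = W / real_of_int (B + 1)" if "b \<in> {0..B}" for b
  proof -
    have "(\<Sum>b\<in>{0..B}. \<Sum>c\<in>{0..C}. \<Sum>a\<in>{0..A}. w a b c) = W"
      unfolding W_def by (subst (2) sum.swap, subst sum.swap) (rule refl)
    then show ?thesis using tri_weight_slice[OF inv2 that]
      by (simp add: w_def tri_weight_def mult_ac)
  qed
  have slice3: "(\<Sum>a\<in>{0..A}. \<Sum>b\<in>{0..B}. w a b c) = W / real_of_int (C + 1)" if "c \<in> {0..C}" for c
  proof -
    have "(\<Sum>c\<in>{0..C}. \<Sum>a\<in>{0..A}. \<Sum>b\<in>{0..B}. w a b c) = W"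
      unfolding W_def by (subst sum.swap, subst (2) sum.swap) (rule refl)
    then show ?thesis using tri_weight_slice[OF inv3 that]
      by (simp add: w_def tri_weight_def mult_ac)
  qed
  have "map_pmf fst p = pmf_of_set {0..A}"
  proof (rule pmf_eq_pmf_of_set)
    fix a assume a: "a \<in> {0..A}"
    have "pmf (map_pmf fst p) a = (\<Sum>x\<in>{x \<in> S. fst x = a}. pmf p x)"
      by (rule pmf_map_eq_sum[OF finS pS])
    also have "\<dots> = (\<Sum>(b, c)\<in>{0..B} \<times> {0..C}. w a b c / W)"
      using a by (intro sum.reindex_bij_witness[of _ "\<lambda>(b, c). (a, b, c)" "\<lambda>(a, b, c). (b, c)"])
        (auto simp: p S_def)
    also have "\<dots> = 1 / real (card {0..A})"
      using slice1[OF a] \<open>W > 0\<close> nonneg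
      by (simp add: sum.cartesian_product[symmetric] sum_divide_distrib[symmetric])
    finally show "pmf (map_pmf fst p) a = 1 / real (card {0..A})" .
  qed (use nonneg pS in \<open>auto simp: S_def\<close>)
  moreover have "map_pmf (fst \<circ> snd) p = pmf_of_set {0..B}"
  proof (rule pmf_eq_pmf_of_set)
    fix b assume b: "b \<in> {0..B}"
    have "pmf (map_pmf (fst \<circ> snd) p) b = (\<Sum>x\<in>{x \<in> S. (fst \<circ> snd) x = b}. pmf p x)"
      by (rule pmf_map_eq_sum[OF finS pS])
    also have "\<dots> = (\<Sum>(c, a)\<in>{0..C} \<times> {0..A}. w a b c / W)"
      using b by (intro sum.reindex_bij_witness[of _ "\<lambda>(c, a). (a, b, c)" "\<lambda>(a, b, c). (c, a)"])
        (auto simp: p S_def)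
    also have "\<dots> = 1 / real (card {0..B})"
      using slice2[OF b] \<open>W > 0\<close> nonneg
      by (simp add: sum.cartesian_product[symmetric] sum_divide_distrib[symmetric])
    finally show "pmf (map_pmf (fst \<circ> snd) p) b = 1 / real (card {0..B})" .
  qed (use nonneg pS in \<open>auto simp: S_def\<close>)
  moreover have "map_pmf (snd \<circ> snd) p = pmf_of_set {0..C}"
  proof (rule pmf_eq_pmf_of_set)
    fix c assume c: "c \<in> {0..C}"
    have "pmf (map_pmf (snd \<circ> snd) p) c = (\<Sum>x\<in>{x \<in> S. (snd \<circ> snd) x = c}. pmf p x)"
      by (rule pmf_map_eq_sum[OF finS pS])
    also have "\<dots> = (\<Sum>(a, b)\<in>{0..A} \<times> {0..B}. w a b c / W)"
      using c by (intro sum.reindex_bij_witness[of _ "\<lambda>(a, b). (a, b, c)" "\<lambda>(a, b, c). (a, b)"])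
        (auto simp: p S_def)
    also have "\<dots> = 1 / real (card {0..C})"
      using slice3[OF c] \<open>W > 0\<close> nonneg
      by (simp add: sum.cartesian_product[symmetric] sum_divide_distrib[symmetric])
    finally show "pmf (map_pmf (snd \<circ> snd) p) c = 1 / real (card {0..C})" .
  qed (use nonneg pS in \<open>auto simp: S_def\<close>)
  moreover have "set_pmf p \<subseteq> {(a, b, c). a + b + c = N}"
  proof clarify
    fix a b c assume "(a, b, c) \<in> set_pmf p"
    then have "w a b c \<noteq> 0" by (auto simp: set_pmf_iff p split: if_splits)
    then show "a + b + c = N" using w_pos supp by blast
  qed
  ultimately show ?thesis using that by blast
qed

lemma map_pmf_shift_interval:
  fixes l u :: int
  assumes "l \<le> u"
  shows "map_pmf (\<lambda>a. a + l) (pmf_of_set {0..u - l}) = pmf_of_set {l..u}"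
proof -
  have "(\<lambda>a. a + l) ` {0..u - l} = {l..u}"
    by (auto simp: image_iff intro!: bexI[of _ "_ - l"])
  then show ?thesis using assms by (subst map_pmf_of_set_inj) (auto simp: inj_on_def)
qed

text \<open>The layer of sum \<open>u\<close> in two coordinates, parametrised by the first: the
  \<open>a\<close> with both \<open>a\<close> and \<open>u - a\<close> in
  \<open>{0..n}\<close>.\<close>

definition pair_range :: "nat \<Rightarrow> int \<Rightarrow> int set" where
  "pair_range n u = {max 0 (u - int n)..min (int n) u}"

text \<open>The interval for \<open>u\<close> has length \<open>min u (2 n - u)\<close>, a function
  that is concave, hence subadditive, on \<open>[0, 2 n]\<close> and symmetric about
  \<open>n\<close>. As \<open>2 n - u = v + w\<close>, the triangle inequalities follow. The lengths
  differ from \<open>u\<close>, \<open>v\<close>, \<open>w\<close> by even numbers, so their sum is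
  even.\<close>

lemma pair_range_coupling:
  assumes "0 \<le> u" and "0 \<le> v" and "0 \<le> w" and sum: "u + v + w = 2 * int n"
  obtains p where "set_pmf p \<subseteq> {(a, b, c). a + b + c = int n}"
    and "map_pmf fst p = pmf_of_set (pair_range n u)"
    and "map_pmf (fst \<circ> snd) p = pmf_of_set (pair_range n v)"
    and "map_pmf (snd \<circ> snd) p = pmf_of_set (pair_range n w)"
proof -
  define lo where "lo u = max 0 (u - int n)" for u
  define hi where "hi u = min (int n) u" for u
  have hi: "hi x = x - lo x" for x by (simp add: lo_def hi_def)
  have le: "lo u \<le> hi u" "lo v \<le> hi v" "lo w \<le> hi w" using assms by (auto simp: lo_def hi_def)
  \<comment> \<open>The intervals are translated to start at 0, which lowers the target sum by the
    three left ends; \<open>?f\<close> translates back.\<close>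
  obtain p where p: "set_pmf p \<subseteq> {(a, b, c). a + b + c = int n - lo u - lo v - lo w}"
    "map_pmf fst p = pmf_of_set {0..hi u - lo u}"
    "map_pmf (fst \<circ> snd) p = pmf_of_set {0..hi v - lo v}"
    "map_pmf (snd \<circ> snd) p = pmf_of_set {0..hi w - lo w}"
  proof (rule uniform_interval_coupling_zero)
    show "hi u - lo u \<le> hi v - lo v + (hi w - lo w)" "hi v - lo v \<le> hi w - lo w + (hi u - lo u)"
      "hi w - lo w \<le> hi u - lo u + (hi v - lo v)"
      using assms unfolding lo_def hi_def by linarith+
    show "hi u - lo u + (hi v - lo v) + (hi w - lo w) = 2 * (int n - lo u - lo v - lo w)"
      using sum by (simp add: hi)
  qed
  let ?f = "\<lambda>(a, b, c). (a + lo u, b + lo v, c + lo w)"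
  have fs: "fst \<circ> ?f = (\<lambda>a. a + lo u) \<circ> fst" "fst \<circ> snd \<circ> ?f = (\<lambda>a. a + lo v) \<circ> (fst \<circ> snd)"
    "snd \<circ> snd \<circ> ?f = (\<lambda>a. a + lo w) \<circ> (snd \<circ> snd)"
    by auto
  have "map_pmf g (map_pmf ?f p) = pmf_of_set (pair_range n x)"
    if "g \<circ> ?f = (\<lambda>a. a + lo x) \<circ> h" and "map_pmf h p = pmf_of_set {0..hi x - lo x}" and "lo x \<le> hi x"
    for g h x
    using that map_pmf_shift_interval[of "lo x" "hi x"]
    by (simp add: pmf.map_comp lo_def[symmetric] hi_def[symmetric] pair_range_def)
      (simp add: pmf.map_comp[symmetric])
  note marg = this[OF fs(1) p(2) le(1)] this[OF fs(2) p(3) le(2)] this[OF fs(3) p(4) le(3)]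
  have "set_pmf (map_pmf ?f p) \<subseteq> {(a, b, c). a + b + c = int n}" using p(1) by force
  then show ?thesis using marg by (rule that)
qed

section \<open>Lattice points and moves in two coordinates\<close>

definition int_box :: "nat \<Rightarrow> ('d \<Rightarrow> int) set" where
  "int_box n = {x. \<forall>i. x i \<in> {0..int n}}"

definition int_layer :: "nat \<Rightarrow> int \<Rightarrow> ('d::finite \<Rightarrow> int) set" where
  "int_layer n r = {x \<in> int_box n. sum x UNIV = r}"

lemma finite_int_box: "finite (int_box n :: ('d::finite \<Rightarrow> int) set)"
proof -
  have "int_box n = (Pi\<^sub>E UNIV (\<lambda>_. {0..int n}) :: ('d \<Rightarrow> int) set)"
    by (auto simp: int_box_def)
  then show ?thesis by (simp add: finite_PiE)
qed

definition set_pair :: "'d \<Rightarrow> 'd \<Rightarrow> ('d \<Rightarrow> int) \<Rightarrow> int \<Rightarrow> 'd \<Rightarrow> int" where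
  "set_pair i j x a = x(i := a, j := x i + x j - a)"

definition pair_class :: "nat \<Rightarrow> 'd \<Rightarrow> 'd \<Rightarrow> ('d \<Rightarrow> int) \<Rightarrow> ('d \<Rightarrow> int) set" where
  "pair_class n i j x =
    {y \<in> int_box n. (\<forall>k. k \<noteq> i \<longrightarrow> k \<noteq> j \<longrightarrow> y k = x k) \<and> y i + y j = x i + x j}"

lemma set_pair_image:
  assumes "x \<in> int_box n" and "i \<noteq> j"
  shows "set_pair i j x ` pair_range n (x i + x j) = pair_class n i j x"
proof (intro equalityI subsetI)
  fix y assume "y \<in> set_pair i j x ` pair_range n (x i + x j)"
  then show "y \<in> pair_class n i j x"
    using assms by (auto simp: set_pair_def pair_class_def int_box_def pair_range_def)
next
  fix y assume y: "y \<in> pair_class n i j x"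
  have "0 \<le> y i" "y i \<le> int n" "0 \<le> y j" "y j \<le> int n"
    using y by (auto simp: pair_class_def int_box_def)
  then have "y i \<in> pair_range n (x i + x j)"
    using y by (auto simp: pair_class_def pair_range_def)
  moreover have "y = set_pair i j x (y i)"
    using y assms(2) by (auto simp: pair_class_def set_pair_def fun_eq_iff)
  ultimately show "y \<in> set_pair i j x ` pair_range n (x i + x j)" by blast
qed

lemma pair_class_refl: "x \<in> int_box n \<Longrightarrow> x \<in> pair_class n i j x"
  by (simp add: pair_class_def)

lemma pair_class_sym: "x \<in> int_box n \<Longrightarrow> y \<in> pair_class n i j x \<Longrightarrow> x \<in> pair_class n i j y"
  by (simp add: pair_class_def)

lemma pair_class_eq: "y \<in> pair_class n i j x \<Longrightarrow> pair_class n i j y = pair_class n i j x"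
  by (auto simp: pair_class_def)

lemma sum_pair_class:
  fixes x y :: "'d::finite \<Rightarrow> int"
  assumes "i \<noteq> j" and "y \<in> pair_class n i j x"
  shows "sum y UNIV = sum x UNIV"
proof -
  have split: "sum f UNIV = f i + f j + sum f (UNIV - {i, j})" for f :: "'d \<Rightarrow> int"
    using assms(1) sum.subset_diff[of "{i, j}" UNIV f] by simp
  have "sum y (UNIV - {i, j}) = sum x (UNIV - {i, j})"
    using assms(2) by (intro sum.cong) (auto simp: pair_class_def)
  then show ?thesis using assms(2) split[of x] split[of y] by (simp add: pair_class_def)
qed

text \<open>The Gibbs sampler for the coordinates \<open>i\<close>, \<open>j\<close>. As an image of
  the uniform law on \<open>pair_range\<close> it inherits couplings of such laws;
  \<open>resample_eq\<close> identifies it with the uniform law on the pair class.\<close>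

definition resample :: "nat \<Rightarrow> 'd \<times> 'd \<Rightarrow> ('d \<Rightarrow> int) \<Rightarrow> ('d \<Rightarrow> int) pmf" where
  "resample n = (\<lambda>(i, j) x. map_pmf (set_pair i j x) (pmf_of_set (pair_range n (x i + x j))))"

lemma resample_eq:
  assumes "x \<in> int_box n" and "i \<noteq> j"
  shows "resample n (i, j) x = pmf_of_set (pair_class n i j x)"
proof -
  have "x i \<in> pair_range n (x i + x j)"
    using assms(1)[unfolded int_box_def] spec[of _ i] spec[of _ j] by (auto simp: pair_range_def)
  then have "pair_range n (x i + x j) \<noteq> {}" by blast
  moreover have "inj_on (set_pair i j x) (pair_range n (x i + x j))"
    using assms(2) by (auto simp: inj_on_def set_pair_def fun_eq_iff split: if_splits)
  ultimately show ?thesis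
    unfolding resample_def set_pair_image[OF assms, symmetric]
    by (simp add: map_pmf_of_set_inj pair_range_def)
qed

lemma
  fixes x :: "'d::finite \<Rightarrow> int"
  assumes "x \<in> int_box n" and "i \<noteq> j"
  shows set_pmf_resample: "set_pmf (resample n (i, j) x) = pair_class n i j x"
    and pmf_resample: "pmf (resample n (i, j) x) y = indicator (pair_class n i j x) y / card (pair_class n i j x)"
proof -
  have "finite (pair_class n i j x)"
    by (rule finite_subset[OF _ finite_int_box[of n]]) (auto simp: pair_class_def)
  moreover have "pair_class n i j x \<noteq> {}" using pair_class_refl[OF assms(1)] by blast
  ultimately show "set_pmf (resample n (i, j) x) = pair_class n i j x"
    and "pmf (resample n (i, j) x) y = indicator (pair_class n i j x) y / card (pair_class n i j x)"
    by (simp_all add: resample_eq[OF assms])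
qed

text \<open>Uniform resampling within the classes of an equivalence relation is a symmetric kernel,
  so its columns sum to 1 as its rows do.\<close>

lemma resample_column_sum:
  fixes y :: "'d::finite \<Rightarrow> int"
  assumes y: "y \<in> int_box n" and ij: "i \<noteq> j"
  shows "(\<Sum>x\<in>int_box n. pmf (resample n (i, j) x) y) = 1"
proof -
  have "(\<Sum>x\<in>int_box n. pmf (resample n (i, j) x) y) = (\<Sum>x\<in>int_box n. pmf (resample n (i, j) y) x)"
  proof (intro sum.cong refl)
    fix x :: "'d \<Rightarrow> int" assume x: "x \<in> int_box n"
    have "y \<in> pair_class n i j x \<longleftrightarrow> x \<in> pair_class n i j y"
      using pair_class_sym[OF x] pair_class_sym[OF y] by blast
    then show "pmf (resample n (i, j) x) y = pmf (resample n (i, j) y) x"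
      using pair_class_eq[of y n i j x]
      by (cases "y \<in> pair_class n i j x") (simp_all add: pmf_resample x y ij)
  qed
  also have "\<dots> = 1"
    using set_pmf_resample[OF y ij] by (intro sum_pmf_eq_1 finite_int_box) (auto simp: pair_class_def)
  finally show ?thesis .
qed

text \<open>Moving a unit from a coordinate where \<open>x\<close> exceeds \<open>y\<close> to one
  where it falls short is a pair move that lowers the l1 distance to \<open>y\<close> by 2. Such
  coordinates exist because the sums agree.\<close>

lemma pair_class_connected:
  fixes x y :: "'d::finite \<Rightarrow> int"
  assumes inv: "\<And>i j x x'. i \<noteq> j \<Longrightarrow> x \<in> int_box n \<Longrightarrow> x' \<in> pair_class n i j x \<Longrightarrow> f x = f x'"
    and "x \<in> int_box n" and y: "y \<in> int_box n" and "sum x UNIV = sum y UNIV"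
  shows "f x = f y"
  using assms(2,4)
proof (induction "nat (\<Sum>k\<in>UNIV. \<bar>x k - y k\<bar>)" arbitrary: x rule: less_induct)
  case less
  show ?case
  proof (cases "x = y")
    case False
    have up: "\<exists>i. x i < y i" 
    proof (rule ccontr)
      assume "\<not> ?thesis"
      then have "\<And>k. y k \<le> x k" by (simp add: not_less)
      moreover obtain k where "x k \<noteq> y k" using False by auto
      ultimately have "sum y UNIV < sum x UNIV"
        by (intro sum_strict_mono_ex1) (auto intro!: exI[of _ k] simp: order_less_le)
      with less.prems show False by simp
    qed
    have down: "\<exists>i. y i < x i" 
    proof (rule ccontr)
      assume "\<not> ?thesis"
      then have "\<And>k. x k \<le> y k" by (simp add: not_less)
      moreover obtain k where "x k \<noteq> y k" using False by auto
      ultimately have "sum x UNIV < sum y UNIV"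
        by (intro sum_strict_mono_ex1) (auto intro!: exI[of _ k] simp: order_less_le)
      with less.prems show False by simp
    qed
    obtain i j where i: "x i < y i" and j: "y j < x j" using up down by blast
    then have ij: "i \<noteq> j" by auto
    define x' where "x' = set_pair i j x (x i + 1)"
    have x': "x' k = (if k = i then x i + 1 else if k = j then x j - 1 else x k)" for k
      using ij by (auto simp: x'_def set_pair_def)
    have x_box: "0 \<le> x k" "x k \<le> int n" and y_box: "0 \<le> y k" "y k \<le> int n" for k
      using less.prems(1) y by (auto simp: int_box_def)
    \<comment> \<open>Every changed coordinate moves towards \<open>y\<close>, so it stays in
      \<open>{0..n}\<close>.\<close>
    have "0 \<le> x' k \<and> x' k \<le> int n" for k
      using x_box[of k] y_box[of k] i j by (auto simp: x')
    then have "x' \<in> int_box n" by (simp add: int_box_def)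
    then have cls: "x' \<in> pair_class n i j x"
      using ij by (auto simp: pair_class_def x')
    have "(\<Sum>k\<in>UNIV. \<bar>x' k - y k\<bar>) < (\<Sum>k\<in>UNIV. \<bar>x k - y k\<bar>)"
      using i j ij by (intro sum_strict_mono_ex1) (auto simp: x' intro!: exI[of _ i])
    moreover have "0 \<le> (\<Sum>k\<in>UNIV. \<bar>x' k - y k\<bar>)" by (intro sum_nonneg) simp
    ultimately have "nat (\<Sum>k\<in>UNIV. \<bar>x' k - y k\<bar>) < nat (\<Sum>k\<in>UNIV. \<bar>x k - y k\<bar>)" by linarith
    then have "f x' = f y"
      using less.hyps \<open>x' \<in> int_box n\<close> sum_pair_class[OF ij cls] less.prems(2) by metis
    then show ?thesis using inv[OF ij less.prems(1) cls] by simp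
  qed simp
qed

section \<open>Coupling of three uniform layers\<close>

lemma exists_below_with_sum:
  fixes w :: "'d::finite \<Rightarrow> int"
  assumes "\<And>i. 0 \<le> w i" and "int m \<le> sum w UNIV"
  shows "\<exists>x. (\<forall>i. 0 \<le> x i \<and> x i \<le> w i) \<and> sum x UNIV = int m"
  using assms(2)
proof (induction m)
  case 0
  show ?case using assms(1) by (intro exI[of _ "\<lambda>_. 0"]) simp
next
  case (Suc m)
  then obtain x where x: "\<forall>i. 0 \<le> x i \<and> x i \<le> w i" "sum x UNIV = int m" by auto
  have "\<exists>i. x i < w i"
  proof (rule ccontr)
    assume "\<not> ?thesis"
    then have "sum w UNIV \<le> sum x UNIV" by (intro sum_mono) (simp add: not_less)
    then show False using Suc.prems x(2) by simp
  qed
  then obtain i where i: "x i < w i" by blast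
  have "sum (x(i := x i + 1)) UNIV = int (Suc m)"
    using x(2) sum.remove[of UNIV i x] sum.remove[of UNIV i "x(i := x i + 1)"] by simp
  then show ?case using x(1) i by (intro exI[of _ "x(i := x i + 1)"]) auto
qed

text \<open>The energy minimiser among laws on \<open>\<Omega>\<close> is the coupling: its
  marginals are constant along pair moves, hence on each layer, which such moves connect.\<close>

lemma uniform_layer_coupling:
  fixes n :: nat and r s t :: int
  assumes nonneg: "0 \<le> r" "0 \<le> s" "0 \<le> t" and total: "r + s + t = int CARD('d::finite) * int n"
  obtains \<pi> :: "(('d::finite \<Rightarrow> int) \<times> ('d::finite \<Rightarrow> int) \<times> ('d::finite \<Rightarrow> int)) pmf"
  where "set_pmf \<pi> \<subseteq> {(x, y, z). \<forall>i. x i + y i + z i = int n}" and "finite (set_pmf \<pi>)"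
    and "int_layer n r \<noteq> ({} :: ('d::finite \<Rightarrow> int) set)" and "map_pmf fst \<pi> = pmf_of_set (int_layer n r)"
    and "int_layer n s \<noteq> ({} :: ('d::finite \<Rightarrow> int) set)" and "map_pmf (fst \<circ> snd) \<pi> = pmf_of_set (int_layer n s)"
    and "int_layer n t \<noteq> ({} :: ('d::finite \<Rightarrow> int) set)" and "map_pmf (snd \<circ> snd) \<pi> = pmf_of_set (int_layer n t)"
proof -
  define box where "box = (int_box n :: ('d \<Rightarrow> int) set)"
  define \<Omega> :: "(('d \<Rightarrow> int) \<times> ('d \<Rightarrow> int) \<times> ('d \<Rightarrow> int)) set" where
    "\<Omega> = {(x, y, z). x \<in> int_layer n r \<and> y \<in> int_layer n s \<and> z \<in> int_layer n t \<and>
      (\<forall>i. x i + y i + z i = int n)}"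
  have fin_box: "finite box" unfolding box_def by (rule finite_int_box)
  have "finite \<Omega>"
    by (rule finite_subset[of _ "box \<times> box \<times> box"])
      (auto simp: \<Omega>_def int_layer_def box_def fin_box[unfolded box_def])
  \<comment> \<open>A point \<open>v\<close> of the box with sum \<open>r + s\<close> is split into
    some \<open>x\<close> below it with sum \<open>r\<close> and the rest with sum \<open>s\<close>;
    the third point is the complement \<open>n - v\<close>.\<close>
  have "\<Omega> \<noteq> {}"
  proof -
    obtain v :: "'d \<Rightarrow> int" where v: "\<And>i. 0 \<le> v i" "\<And>i. v i \<le> int n" "sum v UNIV = r + s"
      using exists_below_with_sum[of "\<lambda>_::'d. int n" "nat (r + s)"] nonneg total by auto
    obtain x where x: "\<And>i. 0 \<le> x i" "\<And>i. x i \<le> v i" "sum x UNIV = r"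
      using exists_below_with_sum[of v "nat r"] nonneg v by auto
    have "(x, \<lambda>i. v i - x i, \<lambda>i. int n - v i) \<in> \<Omega>"
      unfolding \<Omega>_def int_layer_def int_box_def using v x total nonneg
      by (auto simp: sum_subtractf intro: order_trans[of _ "v _"]) (smt (verit) v x)+
    then show ?thesis by blast
  qed
  \<comment> \<open>One coupling is chosen for each triple of pair sums; its value is specified only
    where \<open>pair_range_coupling\<close> applies.\<close>
  define cpl where "cpl u v w = (SOME p :: (int \<times> int \<times> int) pmf.
      set_pmf p \<subseteq> {(a, b, c). a + b + c = int n} \<and> map_pmf fst p = pmf_of_set (pair_range n u) \<and>
      map_pmf (fst \<circ> snd) p = pmf_of_set (pair_range n v) \<and>
      map_pmf (snd \<circ> snd) p = pmf_of_set (pair_range n w))" for u v w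
  have cpl: "set_pmf (cpl u v w) \<subseteq> {(a, b, c). a + b + c = int n}
      \<and> map_pmf fst (cpl u v w) = pmf_of_set (pair_range n u)
      \<and> map_pmf (fst \<circ> snd) (cpl u v w) = pmf_of_set (pair_range n v)
      \<and> map_pmf (snd \<circ> snd) (cpl u v w) = pmf_of_set (pair_range n w)"
    if "0 \<le> u" "0 \<le> v" "0 \<le> w" "u + v + w = 2 * int n" for u v w
    unfolding cpl_def by (rule someI_ex) (metis pair_range_coupling[OF that])
  \<comment> \<open>All three points are redistributed in the same two coordinates with coupled new
    values. The coupling keeps the sum \<open>n\<close> at \<open>i\<close>, and the preserved pair
    sums then keep it at \<open>j\<close>.\<close>
  define T where "T = (\<lambda>(i :: 'd, j) (x, y, z).
      map_pmf (\<lambda>(a, b, c). (set_pair i j x a, set_pair i j y b, set_pair i j z c))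
        (cpl (x i + x j) (y i + y j) (z i + z j)))"
  define I where "I = {(i, j). i \<noteq> (j :: 'd)}"
  define M where "M = {fst, fst \<circ> snd, snd \<circ> snd :: _ \<Rightarrow> ('d \<Rightarrow> int)}"
  have \<Omega>_cpl: "0 \<le> x i + x j" "0 \<le> y i + y j" "0 \<le> z i + z j"
      "(x i + x j) + (y i + y j) + (z i + z j) = 2 * int n"
    if "(x, y, z) \<in> \<Omega>" for x y z i j
  proof -
    show "0 \<le> x i + x j" "0 \<le> y i + y j" "0 \<le> z i + z j"
      using that by (auto simp: \<Omega>_def int_layer_def int_box_def)
    have "x i + y i + z i = int n" "x j + y j + z j = int n" using that by (auto simp: \<Omega>_def)
    then show "(x i + x j) + (y i + y j) + (z i + z j) = 2 * int n" by simp
  qed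
  \<comment> \<open>Projection to one point commutes with \<open>set_pair\<close>, and the marginals
    of \<open>cpl\<close> are the laws that define \<open>resample\<close>.\<close>
  have TK: "map_pmf f (T ij \<omega>) = resample n ij (f \<omega>)" if "\<omega> \<in> \<Omega>" "f \<in> M" for f ij \<omega>
  proof -
    obtain i j where ij: "ij = (i, j)" by force
    obtain x y z where \<omega>: "\<omega> = (x, y, z)" by (cases \<omega>)
    note c = cpl[OF \<Omega>_cpl[OF that(1)[unfolded \<omega>], of i j]]
    let ?c = "cpl (x i + x j) (y i + y j) (z i + z j)"
    have "map_pmf fst (T ij \<omega>) = map_pmf (set_pair i j x) (map_pmf fst ?c)"
      "map_pmf (fst \<circ> snd) (T ij \<omega>) = map_pmf (set_pair i j y) (map_pmf (fst \<circ> snd) ?c)"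
      "map_pmf (snd \<circ> snd) (T ij \<omega>) = map_pmf (set_pair i j z) (map_pmf (snd \<circ> snd) ?c)"
      unfolding T_def ij \<omega> by (auto simp: pmf.map_comp intro!: map_pmf_cong)
    then show ?thesis using c that(2) by (auto simp: M_def resample_def ij \<omega>)
  qed
  have MA: "f \<omega> \<in> box" if "f \<in> M" "\<omega> \<in> \<Omega>" for f \<omega>
    using that by (auto simp: M_def \<Omega>_def int_layer_def box_def)
  have T\<Omega>: "set_pmf (T ij \<omega>) \<subseteq> \<Omega>" if ijI: "ij \<in> I" and \<omega>\<Omega>: "\<omega> \<in> \<Omega>" for ij \<omega>
  proof
    fix \<omega>' assume \<omega>': "\<omega>' \<in> set_pmf (T ij \<omega>)"
    obtain i j where ij: "ij = (i, j)" "i \<noteq> j" using ijI by (auto simp: I_def)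
    obtain x y z where \<omega>: "\<omega> = (x, y, z)" by (cases \<omega>)
    obtain x' y' z' where w': "\<omega>' = (x', y', z')" by (cases \<omega>')
    have "f \<omega>' \<in> pair_class n i j (f \<omega>)" if f: "f \<in> M" for f
    proof -
      have "f \<omega>' \<in> set_pmf (map_pmf f (T ij \<omega>))" using \<omega>' by simp
      then show ?thesis
        using set_pmf_resample[OF MA[OF f \<omega>\<Omega>, unfolded box_def] ij(2)]
        by (simp add: TK[OF \<omega>\<Omega> f] ij(1))
    qed
    from this[of fst] this[of "fst \<circ> snd"] this[of "snd \<circ> snd"]
    have cls: "x' \<in> pair_class n i j x" "y' \<in> pair_class n i j y" "z' \<in> pair_class n i j z"
      by (simp_all add: M_def \<omega> w')
    obtain a b c where abc: "(a, b, c) \<in> set_pmf (cpl (x i + x j) (y i + y j) (z i + z j))"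
      "x' = set_pair i j x a" "y' = set_pair i j y b" "z' = set_pair i j z c"
      using \<omega>' by (auto simp: T_def ij \<omega> w')
    have abc_sum: "a + b + c = int n"
      using cpl[OF \<Omega>_cpl[OF \<omega>\<Omega>[unfolded \<omega>], of i j]] abc(1) by blast
    have xyz: "x k + y k + z k = int n" for k using \<omega>\<Omega> by (auto simp: \<Omega>_def \<omega>)
    have "x' k + y' k + z' k = int n" for k
      using abc_sum xyz[of i] xyz[of j] xyz[of k] by (auto simp: abc set_pair_def)
    then show "\<omega>' \<in> \<Omega>"
      using \<omega>\<Omega> cls sum_pair_class[OF ij(2) cls(1)] sum_pair_class[OF ij(2) cls(2)]
        sum_pair_class[OF ij(2) cls(3)]
      by (auto simp: \<Omega>_def \<omega> w' int_layer_def pair_class_def)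
  qed
  obtain \<pi> where \<pi>: "set_pmf \<pi> \<subseteq> \<Omega>"
    and \<pi>_inv: "\<And>f i x x' a. f \<in> M \<Longrightarrow> i \<in> I \<Longrightarrow> x \<in> box \<Longrightarrow> x' \<in> box \<Longrightarrow>
      a \<in> set_pmf (resample n i x) \<Longrightarrow> a \<in> set_pmf (resample n i x') \<Longrightarrow>
      pmf (map_pmf f \<pi>) x = pmf (map_pmf f \<pi>) x'"
  proof (rule coupling_with_kernel_invariant_marginals[OF \<open>finite \<Omega>\<close> \<open>\<Omega> \<noteq> {}\<close> _ fin_box,
        where M = M and I = I and T = T and K = "resample n"])
    show "finite M" by (simp add: M_def)
    show "set_pmf (resample n i x) \<subseteq> box" if "i \<in> I" "x \<in> box" for i x
      using that by (auto simp: I_def box_def set_pmf_resample pair_class_def)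
    show "(\<Sum>x\<in>box. pmf (resample n i x) a) = 1" if "i \<in> I" "a \<in> box" for i a
      using that resample_column_sum by (auto simp: I_def box_def)
  qed (use MA T\<Omega> TK in blast)+
  have const: "pmf (map_pmf f \<pi>) x = pmf (map_pmf f \<pi>) y"
    if f: "f \<in> M" and xy: "x \<in> int_box n" "y \<in> int_box n" "sum x UNIV = sum y UNIV" for f x y
  proof (rule pair_class_connected[OF _ xy])
    fix i j :: 'd and x x' :: "'d \<Rightarrow> int"
    assume *: "i \<noteq> j" "x \<in> int_box n" "x' \<in> pair_class n i j x"
    then have "x' \<in> int_box n" by (simp add: pair_class_def)
    \<comment> \<open>The point reachable from both \<open>x\<close> and \<open>x'\<close> is
      \<open>x'\<close> itself.\<close>
    with * show "pmf (map_pmf f \<pi>) x = pmf (map_pmf f \<pi>) x'"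
      by (intro \<pi>_inv[OF f, of "(i, j)" _ _ x'])
        (auto simp: I_def box_def set_pmf_resample pair_class_refl)
  qed
  have unif: "int_layer n m \<noteq> ({} :: ('d \<Rightarrow> int) set) \<and> map_pmf f \<pi> = pmf_of_set (int_layer n m)"
    if f: "f \<in> M" and fl: "\<And>\<omega>. \<omega> \<in> \<Omega> \<Longrightarrow> f \<omega> \<in> int_layer n m" for f m
  proof -
    let ?L = "int_layer n m :: ('d \<Rightarrow> int) set"
    have finL: "finite ?L" using finite_int_box by (rule finite_subset[rotated]) (auto simp: int_layer_def)
    have sub: "set_pmf (map_pmf f \<pi>) \<subseteq> ?L" using \<pi> fl by auto
    \<comment> \<open>The layer contains the support of a law, which is never empty.\<close>
    then have ne: "?L \<noteq> {}" using set_pmf_not_empty[of "map_pmf f \<pi>"] by blast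
    have "map_pmf f \<pi> = pmf_of_set ?L"
    proof (rule pmf_eq_pmf_of_set[OF finL ne sub])
      fix x assume x: "x \<in> ?L"
      have "1 = (\<Sum>y\<in>?L. pmf (map_pmf f \<pi>) y)" by (rule sum_pmf_eq_1[OF finL sub, symmetric])
      also have "\<dots> = (\<Sum>y\<in>?L. pmf (map_pmf f \<pi>) x)"
        by (rule sum.cong[OF refl], rule const[OF f]) (use x in \<open>auto simp: int_layer_def\<close>)
      also have "\<dots> = real (card ?L) * pmf (map_pmf f \<pi>) x" by simp
      finally show "pmf (map_pmf f \<pi>) x = 1 / real (card ?L)"
        using card_gt_0_iff[of ?L] finL ne by (metis nonzero_mult_div_cancel_left of_nat_0_less_iff order_less_irrefl)
    qed
    with ne show ?thesis by blast
  qed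
  have "set_pmf \<pi> \<subseteq> {(x, y, z). \<forall>i. x i + y i + z i = int n}" using \<pi> by (auto simp: \<Omega>_def)
  moreover have "finite (set_pmf \<pi>)" using \<pi> \<open>finite \<Omega>\<close> finite_subset by blast
  ultimately show ?thesis
    using that unif[of fst r] unif[of "fst \<circ> snd" s] unif[of "snd \<circ> snd" t]
    by (auto simp: M_def \<Omega>_def)
qed

section \<open>Transfer to Borel measures on Euclidean space\<close>

definition real_point :: "('d::finite \<Rightarrow> int) \<Rightarrow> real ^ 'd" where
  "real_point x = (\<chi> i. real_of_int (x i))"

lemma lattice_layer_eq: "lattice_layer n r = real_point ` int_layer n r"
proof (intro equalityI subsetI)
  fix v :: "real ^ 'd" assume v: "v \<in> lattice_layer n r"
  define x where "x i = \<lfloor>v $ i\<rfloor>" for i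
  have x: "v $ i = real_of_int (x i)" "x i \<in> {0..int n}" for i
  proof -
    obtain k where "v $ i = real k" "k \<in> {0..n}" using v unfolding lattice_layer_def by blast
    then show "v $ i = real_of_int (x i)" "x i \<in> {0..int n}" by (auto simp: x_def)
  qed
  have "real_of_int (sum x UNIV) = real_of_int r"
    using v x(1) by (simp add: lattice_layer_def)
  then have "sum x UNIV = r" by (simp only: of_int_eq_iff)
  then have "x \<in> int_layer n r" using x(2) by (simp add: int_layer_def int_box_def)
  moreover have "v = real_point x" by (simp add: real_point_def x(1) vec_eq_iff)
  ultimately show "v \<in> real_point ` int_layer n r" by blast
next
  fix v :: "real ^ 'd" assume "v \<in> real_point ` int_layer n r"
  then obtain x where x: "v = real_point x" "x \<in> int_layer n r" by blast
  have "real_of_int (x i) \<in> real ` {0..n}" for i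
    using x(2) by (intro image_eqI[of _ _ "nat (x i)"]) (auto simp: int_layer_def int_box_def nat_le_iff)
  then show "v \<in> lattice_layer n r"
    using x by (auto simp: lattice_layer_def real_point_def int_layer_def simp flip: of_int_sum)
qed

text \<open>Injective maps carry uniform laws to uniform laws, so each layer distribution becomes
  the law of a random vector on the common space \<open>\<pi>\<close>.\<close>

lemma unif_lattice_layer:
  fixes f :: "'w \<Rightarrow> 'd::finite \<Rightarrow> int"
  assumes "int_layer n r \<noteq> ({} :: ('d \<Rightarrow> int) set)" and "map_pmf f \<pi> = pmf_of_set (int_layer n r)"
  shows "unif (lattice_layer n r :: (real ^ 'd) set)
    = distr (measure_pmf \<pi>) borel (\<lambda>\<omega>. real_point (f \<omega>))"
proof -
  have "finite (int_layer n r :: ('d \<Rightarrow> int) set)"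
    using finite_int_box by (rule finite_subset[rotated]) (auto simp: int_layer_def)
  moreover have "inj_on real_point (int_layer n r :: ('d \<Rightarrow> int) set)"
    by (auto simp: inj_on_def real_point_def vec_eq_iff)
  ultimately have "pmf_of_set (lattice_layer n r) = map_pmf real_point (map_pmf f \<pi>)"
    unfolding assms(2) lattice_layer_eq using assms(1) by (simp add: map_pmf_of_set_inj)
  then show ?thesis
    unfolding unif_def by (simp add: pmf.map_comp map_pmf_rep_eq distr_distr comp_def)
qed

text \<open>The coupling is the joint law of \<open>(X, Y, Z)\<close>. Finite support gives
  integrability, and by linearity \<open>c\<close> is the sum of the three expectations.\<close>

lemma jointly_mixable_finite_pmf:
  fixes X Y Z :: "'w \<Rightarrow> 'a::euclidean_space"
  assumes fin: "finite (set_pmf \<pi>)" and const: "\<And>\<omega>. \<omega> \<in> set_pmf \<pi> \<Longrightarrow> X \<omega> + Y \<omega> + Z \<omega> = c"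
  shows "jointly_mixable (distr (measure_pmf \<pi>) borel X) (distr (measure_pmf \<pi>) borel Y)
    (distr (measure_pmf \<pi>) borel Z)"
proof -
  have int: "integrable (measure_pmf \<pi>) f" for f :: "'w \<Rightarrow> 'a"
    by (rule integrable_measure_pmf_finite[OF fin])
  have "(\<integral>\<omega>. X \<omega> \<partial>\<pi>) + (\<integral>\<omega>. Y \<omega> \<partial>\<pi>) + (\<integral>\<omega>. Z \<omega> \<partial>\<pi>) = (\<integral>\<omega>. X \<omega> + Y \<omega> + Z \<omega> \<partial>\<pi>)"
    by (simp add: int)
  also have "\<dots> = (\<integral>\<omega>. c \<partial>\<pi>)"
    by (intro integral_cong_AE) (auto simp: AE_measure_pmf_iff const)
  finally have sum: "(\<integral>\<omega>. X \<omega> \<partial>\<pi>) + (\<integral>\<omega>. Y \<omega> \<partial>\<pi>) + (\<integral>\<omega>. Z \<omega> \<partial>\<pi>) = c" by simp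
  define P where "P = distr (measure_pmf \<pi>) (borel \<Otimes>\<^sub>M (borel \<Otimes>\<^sub>M borel)) (\<lambda>\<omega>. (X \<omega>, Y \<omega>, Z \<omega>))"
  have "coupling3 P (distr (measure_pmf \<pi>) borel X) (distr (measure_pmf \<pi>) borel Y)
    (distr (measure_pmf \<pi>) borel Z)"
  proof -
    have "(\<lambda>(x, y, z). x) \<in> (borel \<Otimes>\<^sub>M (borel \<Otimes>\<^sub>M borel)) \<rightarrow>\<^sub>M (borel :: 'a measure)"
      "(\<lambda>(x, y, z). y) \<in> (borel \<Otimes>\<^sub>M (borel \<Otimes>\<^sub>M borel)) \<rightarrow>\<^sub>M (borel :: 'a measure)"
      "(\<lambda>(x, y, z). z) \<in> (borel \<Otimes>\<^sub>M (borel \<Otimes>\<^sub>M borel)) \<rightarrow>\<^sub>M (borel :: 'a measure)"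
      by measurable
    moreover have meas: "(\<lambda>\<omega>. (X \<omega>, Y \<omega>, Z \<omega>)) \<in> measure_pmf \<pi> \<rightarrow>\<^sub>M (borel \<Otimes>\<^sub>M (borel \<Otimes>\<^sub>M borel))"
      by measurable
    ultimately show ?thesis
      unfolding coupling3_def P_def
      by (auto simp: distr_distr comp_def intro!: measure_pmf.prob_space_distr)
  qed
  moreover have "AE (x, y, z) in P. x + y + z = c"
    unfolding P_def
  proof (subst AE_distr_iff)
    show "{x \<in> space (borel \<Otimes>\<^sub>M (borel \<Otimes>\<^sub>M borel)). case x of (x, y, z) \<Rightarrow> x + y + z = c}
      \<in> sets (borel \<Otimes>\<^sub>M (borel \<Otimes>\<^sub>M (borel :: 'a measure)))"
      by measurable
  qed (auto simp: AE_measure_pmf_iff const space_pair_measure)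
  ultimately show ?thesis
    unfolding jointly_mixable_def by (auto simp: integrable_distr_eq integral_distr int sum)
qed

theorem theorem1p5:
  fixes n :: nat and r s t :: int
  assumes "0 \<le> r" and "0 \<le> s" and "0 \<le> t"
    and "r + s + t = int CARD('d::finite) * int n"
  shows "jointly_mixable
           (unif (lattice_layer n r :: (real ^ 'd) set))
           (unif (lattice_layer n s :: (real ^ 'd) set))
           (unif (lattice_layer n t :: (real ^ 'd) set))"
proof -
  obtain \<pi> :: "(('d \<Rightarrow> int) \<times> ('d \<Rightarrow> int) \<times> ('d \<Rightarrow> int)) pmf"
    where sum: "set_pmf \<pi> \<subseteq> {(x, y, z). \<forall>i. x i + y i + z i = int n}" and fin: "finite (set_pmf \<pi>)"
    and r: "int_layer n r \<noteq> ({} :: ('d \<Rightarrow> int) set)" "map_pmf fst \<pi> = pmf_of_set (int_layer n r)"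
    and s: "int_layer n s \<noteq> ({} :: ('d \<Rightarrow> int) set)" "map_pmf (fst \<circ> snd) \<pi> = pmf_of_set (int_layer n s)"
    and t: "int_layer n t \<noteq> ({} :: ('d \<Rightarrow> int) set)" "map_pmf (snd \<circ> snd) \<pi> = pmf_of_set (int_layer n t)"
    by (rule uniform_layer_coupling[OF assms])
  show ?thesis
    unfolding unif_lattice_layer[OF r] unif_lattice_layer[OF s] unif_lattice_layer[OF t]
  proof (rule jointly_mixable_finite_pmf[OF fin])
    fix \<omega> assume "\<omega> \<in> set_pmf \<pi>"
    then have "fst \<omega> i + (fst \<circ> snd) \<omega> i + (snd \<circ> snd) \<omega> i = int n" for i
      using sum by (cases \<omega>) auto
    then show "real_point (fst \<omega>) + real_point ((fst \<circ> snd) \<omega>) + real_point ((snd \<circ> snd) \<omega>)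
      = (\<chi> i. real n)"
      by (simp add: real_point_def vec_eq_iff flip: of_int_add)
  qed
qed

end
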